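(* The string equations determine the genus $0$ invariants $N_{0,n}(b_1,\dots,b_n)$.
   Context: For integers $g\ge0$, $n>0$ with $2g-2+n>0$ and positive integers $b_1,\dots,b_n$, $N_{g,n}(b_1,\dots,b_n)\in\mathbb{Q}$ is the sum of $1/|\mathrm{Aut}|$ over isomorphism classes of connected genus $g$ branched covers of $S^2$ which are unramified over $S^2\setminus\{0,1,\infty\}$, whose fibre over $\infty$ consists of $n$ points labelled $p_1,\dots,p_n$ with ramification $b_i$ at $p_i$, with ramification $(2,2,\dots,2)$ over $1$, and with ramification greater than $1$ at every point over $0$. The genus $0$ invariants are the $N_{0,n}$, $n\ge3$. The string equations are the two relations $$N_{g,n+1}(1,b_1,\dots,b_n)=\sum_{j=1}^n\sum_{k=1}^{b_j}k\,N_{g,n}(b_1,\dots,b_n)|_{b_j=k},$$ $$N_{g,n+1}(2,b_1,\dots,b_n)=\sum_{j=1}^n\sum_{k=1}^{b_j}k\,N_{g,n}(b_1,\dots,b_n)|_{b_j=k}-\frac12\sum_{j=1}^nb_jN_{g,n}(b_1,\dots,b_n),$$ where $|_{b_j=k}$ means that the $j$-th argument is replaced by $k$. Background facts about the $N_{g,n}$: $N_{0,3}(b_1,b_2,b_3)=1$ if $b_1+b_2+b_3$ is even and $0$ otherwise; $N_{g,n}$ vanishes when the number of odd $b_i$ is odd; and $N_{g,n}$ is a symmetric quasi-polynomial, meaning that for each $k$ it agrees, when $b_i$ is odd for $i\le k$ and even for $i>k$, with a polynomial $N_{g,n}^{(k)}$ in $b_1^2,\dots,b_n^2$ that is symmetric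 in $b_1,\dots,b_k$ and in $b_{k+1},\dots,b_n$; in genus $0$ this polynomial has degree at most $n-3$ in the $b_i^2$.
   Formalization: The first string equation is imposed only when b_1+...+b_n is odd and the second only when it is even; read for all b_i they contradict parity vanishing, e.g. N_{0,4}(1,2,2,2)=0 but the right side is 6. *)

theory Defs
  imports "HOL-Analysis.Analysis" "HOL-Homology.Homology"
begin

definition riemann_sphere :: "complex option topology" where
  "riemann_sphere = Alexandroff_compactification euclidean"

text \<open>
  In suitable local coordinates centred at \<open>x\<close> and \<open>f x\<close> the map \<open>f\<close> is \<open>z \<mapsto> z ^ k\<close>.
\<close>

definition has_ramification ::
  "'a topology \<Rightarrow> 'b topology \<Rightarrow> ('a \<Rightarrow> 'b) \<Rightarrow> 'a \<Rightarrow> nat \<Rightarrow> bool" where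
  "has_ramification X Y f x k \<longleftrightarrow> k > 0 \<and>
    (\<exists>U V \<phi> \<psi>. openin X U \<and> x \<in> U \<and> openin Y V \<and> f ` U \<subseteq> V \<and>
       homeomorphic_map (subtopology X U) (top_of_set (ball (0::complex) 1)) \<phi> \<and>
       homeomorphic_map (subtopology Y V) (top_of_set (ball (0::complex) 1)) \<psi> \<and>
       \<phi> x = 0 \<and> \<psi> (f x) = 0 \<and> (\<forall>y\<in>U. \<psi> (f y) = \<phi> y ^ k))"

text \<open>
  The charts in the definition of ramification make the total space of a branched cover a
  closed surface; it is orientable because it is a branched cover of the sphere.
\<close>

definition connected_branched_cover ::
  "'a topology \<Rightarrow> 'b topology \<Rightarrow> ('a \<Rightarrow> 'b) \<Rightarrow> bool" where
  "connected_branched_cover X Y f \<longleftrightarrow>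
     compact_space X \<and> Hausdorff_space X \<and> connected_space X \<and> continuous_map X Y f \<and>
     (\<forall>x\<in>topspace X. \<exists>k. has_ramification X Y f x k)"

definition has_genus :: "'a topology \<Rightarrow> nat \<Rightarrow> bool" where
  "has_genus X g \<longleftrightarrow> homology_group 1 X \<cong> free_Abelian_group {..<2 * g}"

text \<open>
  A cover with labelled fibre over infinity: the total space, the covering map, and the list of
  labelled points. Taking the points of the total space from the type of real numbers loses no
  isomorphism class, since a closed surface has the cardinality of the continuum and the
  topology is arbitrary.
\<close>

type_synonym labelled_cover = "real topology \<times> (real \<Rightarrow> complex option) \<times> real list"

definition covers :: "nat \<Rightarrow> nat list \<Rightarrow> labelled_cover set" where
  "covers g bs = {(X, f, ps).
     connected_branched_cover X riemann_sphere f \<and> has_genus X g \<and>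
     (\<forall>x\<in>topspace X. f x \<notin> {Some 0, Some 1, None} \<longrightarrow> has_ramification X riemann_sphere f x 1) \<and>
     distinct ps \<and> set ps = {x \<in> topspace X. f x = None} \<and>
     length ps = length bs \<and>
     (\<forall>i<length bs. has_ramification X riemann_sphere f (ps ! i) (bs ! i)) \<and>
     (\<forall>x\<in>topspace X. f x = Some 1 \<longrightarrow> has_ramification X riemann_sphere f x 2) \<and>
     (\<forall>x\<in>topspace X. f x = Some 0 \<longrightarrow> (\<exists>k>1. has_ramification X riemann_sphere f x k))}"

text \<open>
  Isomorphisms respect the labels. They are taken extensional, so that the cardinality of an
  automorphism group counts each homeomorphism once.
\<close>

definition cover_isos :: "labelled_cover \<Rightarrow> labelled_cover \<Rightarrow> (real \<Rightarrow> real) set" where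
  "cover_isos = (\<lambda>(X, f, ps) (Y, f', qs).
     {h \<in> extensional (topspace X). homeomorphic_map X Y h \<and>
        (\<forall>x\<in>topspace X. f' (h x) = f x) \<and> map h ps = qs})"

definition cover_iso_rel :: "nat \<Rightarrow> nat list \<Rightarrow> (labelled_cover \<times> labelled_cover) set" where
  "cover_iso_rel g bs =
     {(c, d). c \<in> covers g bs \<and> d \<in> covers g bs \<and> cover_isos c d \<noteq> {}}"

definition Ngn :: "nat \<Rightarrow> nat list \<Rightarrow> rat" where
  "Ngn g bs = (\<Sum>C\<in>covers g bs // cover_iso_rel g bs.
     (let c = (SOME c. c \<in> C) in 1 / of_nat (card (cover_isos c c))))"

text \<open>
  The parity conditions are the ones under which the total of the arguments on the left is even.
  For the other parity the left-hand sides vanish while the sums on the right need not: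
  for \<open>[2, 2, 2]\<close> and \<open>g = 0\<close> the first sum is \<open>6\<close>.
\<close>

definition string_equations :: "nat \<Rightarrow> (nat list \<Rightarrow> rat) \<Rightarrow> bool" where
  "string_equations g F \<longleftrightarrow>
     (\<forall>bs. bs \<noteq> [] \<and> 2 * g + length bs > 2 \<and> (\<forall>b\<in>set bs. b > 0) \<longrightarrow>
       (odd (sum_list bs) \<longrightarrow>
          F (1 # bs) = (\<Sum>j<length bs. \<Sum>k=1..bs ! j. of_nat k * F (bs[j := k]))) \<and>
       (even (sum_list bs) \<longrightarrow>
          F (2 # bs) = (\<Sum>j<length bs. \<Sum>k=1..bs ! j. of_nat k * F (bs[j := k]))
                       - 1 / 2 * (\<Sum>j<length bs. of_nat (bs ! j) * F bs)))"

text \<open>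
  \<open>P\<close> is a polynomial function of \<open>n\<close> variables of total degree at most \<open>d\<close>;
  lists \<open>\<alpha>\<close> are exponent vectors.
\<close>

definition polynomial_of_degree_le :: "nat \<Rightarrow> nat \<Rightarrow> (rat list \<Rightarrow> rat) \<Rightarrow> bool" where
  "polynomial_of_degree_le n d P \<longleftrightarrow>
     (\<exists>c :: nat list \<Rightarrow> rat. \<forall>xs. length xs = n \<longrightarrow>
        P xs = (\<Sum>\<alpha> | length \<alpha> = n \<and> sum_list \<alpha> \<le> d. c \<alpha> * (\<Prod>i<n. xs ! i ^ (\<alpha> ! i))))"

definition symmetric_in_blocks :: "nat \<Rightarrow> nat \<Rightarrow> (rat list \<Rightarrow> rat) \<Rightarrow> bool" where
  "symmetric_in_blocks k n P \<longleftrightarrow>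
     (\<forall>xs xs' ys ys'. length xs = k \<and> length xs + length ys = n \<and>
        mset xs = mset xs' \<and> mset ys = mset ys' \<longrightarrow> P (xs @ ys) = P (xs' @ ys'))"

definition symmetric_quasi_polynomial :: "nat \<Rightarrow> nat \<Rightarrow> (nat list \<Rightarrow> rat) \<Rightarrow> bool" where
  "symmetric_quasi_polynomial n d F \<longleftrightarrow>
     (\<forall>bs cs. length bs = n \<and> (\<forall>b\<in>set bs. b > 0) \<and> mset bs = mset cs \<longrightarrow> F bs = F cs) \<and>
     (\<forall>k\<le>n. \<exists>P. polynomial_of_degree_le n d P \<and> symmetric_in_blocks k n P \<and>
        (\<forall>bs. length bs = n \<and> (\<forall>b\<in>set bs. b > 0) \<and>
              (\<forall>i<n. odd (bs ! i) \<longleftrightarrow> i < k) \<longrightarrow>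
           F bs = P (map (\<lambda>b. (of_nat b)\<^sup>2) bs)))"

definition genus0_background :: "(nat list \<Rightarrow> rat) \<Rightarrow> bool" where
  "genus0_background F \<longleftrightarrow>
     (\<forall>b1>0. \<forall>b2>0. \<forall>b3>0. F [b1, b2, b3] = (if even (b1 + b2 + b3) then 1 else 0)) \<and>
     (\<forall>bs. length bs \<ge> 3 \<and> (\<forall>b\<in>set bs. b > 0) \<and> odd (length (filter odd bs)) \<longrightarrow> F bs = 0) \<and>
     (\<forall>n\<ge>3. symmetric_quasi_polynomial n (n - 3) F)"

end

theory Submission
  imports Defs
begin

text \<open>
  Two solutions of the string equations that agree on \<open>n\<close> arguments agree on \<open>n + 1\<close> arguments
  as soon as one of these is \<open>1\<close> or \<open>2\<close>. For arguments of fixed parities, their difference is thus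
  a polynomial in the squares that vanishes whenever an odd argument equals \<open>1\<close> or an even one
  equals \<open>2\<close>. It would be divisible by the product over all \<open>n + 1\<close> variables \<open>x\<^sub>i\<close> of
  \<open>x\<^sub>i - 1\<close> or \<open>x\<^sub>i - 4\<close>, but its degree is at most \<open>n - 2\<close>, so it is zero.
\<close>

text \<open>
  Divisibility is replaced by the mixed difference: the alternating sum of \<open>P\<close> over all ways of
  substituting \<open>as ! i\<close> for some of the \<open>xs ! i\<close> kills every monomial that omits a variable.
\<close>

lemma polynomial_eq_0_if_vanishes_on_hyperplanes:
  assumes P: "polynomial_of_degree_le n d P" and "d < n" and "length xs = n"
    and vanishes: "\<And>S. S \<subseteq> {..<n} \<Longrightarrow> S \<noteq> {} \<Longrightarrow>
      P (map (\<lambda>i. if i \<in> S then as ! i else xs ! i) [0..<n]) = 0"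
  shows "P xs = 0"
proof -
  let ?E = "{\<alpha>. length \<alpha> = n \<and> sum_list \<alpha> \<le> d}"
  let ?sub = "\<lambda>S. map (\<lambda>i. if i \<in> S then as ! i else xs ! i) [0..<n]"
  obtain c where c: "\<And>ys. length ys = n \<Longrightarrow>
      P ys = (\<Sum>\<alpha>\<in>?E. c \<alpha> * (\<Prod>i<n. ys ! i ^ (\<alpha> ! i)))"
    using P unfolding polynomial_of_degree_le_def by blast
  have difference: "(\<Sum>S\<in>Pow {..<n}. (-1) ^ card S * (\<Prod>i<n. ?sub S ! i ^ (\<alpha> ! i))) = 0"
    if "\<alpha> \<in> ?E" for \<alpha> :: "nat list"
  proof -
    \<comment> \<open>With all \<open>n\<close> exponents at least 1 the total degree would exceed
      \<open>d\<close>.\<close>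
    have "\<exists>i<n. \<alpha> ! i = 0"
    proof (rule ccontr)
      assume "\<not> (\<exists>i<n. \<alpha> ! i = 0)"
      then have "(\<Sum>i<n. 1) \<le> (\<Sum>i<n. \<alpha> ! i)"
        by (intro sum_mono) (auto simp: Suc_le_eq)
      moreover have "(\<Sum>i<n. \<alpha> ! i) = sum_list \<alpha>"
        using that by (auto simp: sum_list_sum_nth lessThan_atLeast0)
      ultimately show False
        using that \<open>d < n\<close> by simp
    qed
    \<comment> \<open>Where the exponent is 0, both powers are 1 and cancel. The expansion of this
      product, with \<open>S\<close> the set of factors from which the \<open>as\<close> term is
      picked, is the alternating sum.\<close>
    then have "(\<Prod>i<n. - (as ! i ^ (\<alpha> ! i)) + xs ! i ^ (\<alpha> ! i)) = 0"
      by (intro prod_zero) force+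
    then have "0 = (\<Prod>i<n. - (as ! i ^ (\<alpha> ! i)) + xs ! i ^ (\<alpha> ! i))" ..
    also have "\<dots> = (\<Sum>S\<in>Pow {..<n}.
        (\<Prod>i\<in>S. - (as ! i ^ (\<alpha> ! i))) * (\<Prod>i\<in>{..<n} - S. xs ! i ^ (\<alpha> ! i)))"
      by (rule prod_add) simp
    also have "\<dots> = (\<Sum>S\<in>Pow {..<n}. (-1) ^ card S * (\<Prod>i<n. ?sub S ! i ^ (\<alpha> ! i)))"
    proof (rule sum.cong)
      fix S assume "S \<in> Pow {..<n}"
      then have "S \<subseteq> {..<n}" by simp
      then have "(\<Prod>i<n. ?sub S ! i ^ (\<alpha> ! i)) =
          (\<Prod>i\<in>{..<n} - S. ?sub S ! i ^ (\<alpha> ! i)) * (\<Prod>i\<in>S. ?sub S ! i ^ (\<alpha> ! i))"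
        by (intro prod.subset_diff) auto
      also have "\<dots> = (\<Prod>i\<in>{..<n} - S. xs ! i ^ (\<alpha> ! i)) * (\<Prod>i\<in>S. as ! i ^ (\<alpha> ! i))"
        using \<open>S \<subseteq> {..<n}\<close> by (intro arg_cong2[where f = "(*)"] prod.cong) auto
      finally show "(\<Prod>i\<in>S. - (as ! i ^ (\<alpha> ! i))) * (\<Prod>i\<in>{..<n} - S. xs ! i ^ (\<alpha> ! i)) =
          (-1) ^ card S * (\<Prod>i<n. ?sub S ! i ^ (\<alpha> ! i))"
        by (simp add: prod_uminus)
    qed simp
    finally show ?thesis by simp
  qed
  have "(\<Sum>S\<in>Pow {..<n}. (-1) ^ card S * P (?sub S)) =
      (\<Sum>S\<in>Pow {..<n}. \<Sum>\<alpha>\<in>?E. c \<alpha> * ((-1) ^ card S * (\<Prod>i<n. ?sub S ! i ^ (\<alpha> ! i))))"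
    by (intro sum.cong refl, subst c) (simp_all only: length_map length_upt sum_distrib_left
      mult.left_commute minus_nat.diff_0)
  also have "\<dots> =
      (\<Sum>\<alpha>\<in>?E. c \<alpha> * (\<Sum>S\<in>Pow {..<n}. (-1) ^ card S * (\<Prod>i<n. ?sub S ! i ^ (\<alpha> ! i))))"
    by (subst sum.swap) (simp only: sum_distrib_left)
  also have "\<dots> = 0"
    by (intro sum.neutral ballI) (simp only: difference mult_zero_right)
  finally have "(\<Sum>S\<in>Pow {..<n}. (-1) ^ card S * P (?sub S)) = 0" .
  \<comment> \<open>By \<open>vanishes\<close> only the empty substitution contributes, and its term
    is \<open>P xs\<close>.\<close>
  moreover have "(\<Sum>S\<in>Pow {..<n}. (-1) ^ card S * P (?sub S)) =
      (\<Sum>S\<in>{{}}. (-1) ^ card S * P (?sub S))"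
    by (rule sum.mono_neutral_right) (auto simp: vanishes)
  moreover have "?sub {} = xs"
    using \<open>length xs = n\<close> by (auto intro: nth_equalityI)
  ultimately show ?thesis by simp
qed

lemma polynomial_of_degree_le_diff:
  assumes "polynomial_of_degree_le n d P" "polynomial_of_degree_le n d Q"
  shows "polynomial_of_degree_le n d (\<lambda>xs. P xs - Q xs)"
proof -
  let ?value = "\<lambda>c xs. \<Sum>\<alpha> | length \<alpha> = n \<and> sum_list \<alpha> \<le> d. c \<alpha> * (\<Prod>i<n. xs ! i ^ (\<alpha> ! i))"
  obtain c where "\<And>xs. length xs = n \<Longrightarrow> P xs = ?value c xs"
    using assms(1) unfolding polynomial_of_degree_le_def by blast
  moreover obtain c' where "\<And>xs. length xs = n \<Longrightarrow> Q xs = ?value c' xs"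
    using assms(2) unfolding polynomial_of_degree_le_def by blast
  ultimately have "\<forall>xs. length xs = n \<longrightarrow> P xs - Q xs = ?value (\<lambda>\<alpha>. c \<alpha> - c' \<alpha>) xs"
    by (simp add: left_diff_distrib sum_subtractf)
  then show ?thesis
    unfolding polynomial_of_degree_le_def by (rule exI[of _ "\<lambda>\<alpha>. c \<alpha> - c' \<alpha>"])
qed

lemma odd_sum_list_iff: "odd (sum_list bs) \<longleftrightarrow> odd (length (filter odd bs))"
  for bs :: "nat list"
  by (induction bs) auto

lemma genus0_background_mset_eq:
  assumes "genus0_background F" "length bs \<ge> 3" "\<forall>b\<in>set bs. b > 0" "mset bs = mset cs"
  shows "F bs = F cs"
  using assms unfolding genus0_background_def symmetric_quasi_polynomial_def by blast

lemma genus0_background_odd: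
  assumes "genus0_background F" "length bs \<ge> 3" "\<forall>b\<in>set bs. b > 0" "odd (sum_list bs)"
  shows "F bs = 0"
  using assms unfolding genus0_background_def odd_sum_list_iff by blast

lemma genus0_background_polynomial:
  assumes "genus0_background F" "n \<ge> 3" "k \<le> n"
  obtains P where "polynomial_of_degree_le n (n - 3) P"
    and "\<And>bs. length bs = n \<Longrightarrow> \<forall>b\<in>set bs. b > 0 \<Longrightarrow> \<forall>i<n. odd (bs ! i) \<longleftrightarrow> i < k \<Longrightarrow>
      F bs = P (map (\<lambda>b. (of_nat b)\<^sup>2) bs)"
proof -
  have "symmetric_quasi_polynomial n (n - 3) F"
    using assms(1,2) by (simp add: genus0_background_def)
  then have "\<exists>P. polynomial_of_degree_le n (n - 3) P \<and> symmetric_in_blocks k n P \<and>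
      (\<forall>bs. length bs = n \<and> (\<forall>b\<in>set bs. b > 0) \<and> (\<forall>i<n. odd (bs ! i) \<longleftrightarrow> i < k) \<longrightarrow>
        F bs = P (map (\<lambda>b. (of_nat b)\<^sup>2) bs))"
    using assms(3) by (simp only: symmetric_quasi_polynomial_def)
  then show thesis
    by (elim exE conjE) (rule that, simp_all)
qed

text \<open>The right-hand sides use values only at lists as long as \<open>bs\<close>, and these
  stay positive because \<open>k\<close> starts at 1. So both functions have the same right-hand
  sides.\<close>

lemma string_equations_agree:
  assumes F: "string_equations g F" and G: "string_equations g G"
    and bs: "bs \<noteq> []" "2 * g + length bs > 2" "\<forall>b\<in>set bs. b > 0"
    and agree: "\<And>cs. length cs = length bs \<Longrightarrow> \<forall>c\<in>set cs. c > 0 \<Longrightarrow> F cs = G cs"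
  shows "odd (sum_list bs) \<Longrightarrow> F (1 # bs) = G (1 # bs)"
    and "even (sum_list bs) \<Longrightarrow> F (2 # bs) = G (2 # bs)"
proof -
  have "F (bs[j := k]) = G (bs[j := k])" if "k \<ge> 1" for j k
    using that bs(3) by (intro agree) (auto dest!: subsetD[OF set_update_subset_insert])
  then have *: "(\<Sum>j<length bs. \<Sum>k=1..bs ! j. of_nat k * F (bs[j := k])) =
      (\<Sum>j<length bs. \<Sum>k=1..bs ! j. of_nat k * G (bs[j := k]))"
    by (intro sum.cong) auto
  have "F bs = G bs"
    using bs(3) by (intro agree) auto
  show "F (1 # bs) = G (1 # bs)" if "odd (sum_list bs)"
    using F G bs that unfolding string_equations_def by (simp only: * simp_thms)
  show "F (2 # bs) = G (2 # bs)" if "even (sum_list bs)"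
    using F G bs that unfolding string_equations_def by (simp only: * \<open>F bs = G bs\<close> simp_thms)
qed

text \<open>If the total is odd, both values are 0. Otherwise symmetry moves the entry
  \<open>b\<close> to the front, where a string equation rewrites both values.\<close>

lemma genus0_step_special:
  assumes F: "genus0_background F" "string_equations 0 F"
    and G: "genus0_background G" "string_equations 0 G"
    and agree: "\<And>cs. length cs = n \<Longrightarrow> \<forall>c\<in>set cs. c > 0 \<Longrightarrow> F cs = G cs"
    and bs: "n \<ge> 3" "length bs = Suc n" "\<forall>b\<in>set bs. b > 0" "b \<in> set bs" "b = 1 \<or> b = 2"
  shows "F bs = G bs"
proof (cases "odd (sum_list bs)")
  case True
  then show ?thesis
    using genus0_background_odd[OF F(1), of bs] genus0_background_odd[OF G(1), of bs] bs by simp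
next
  case False
  let ?cs = "remove1 b bs"
  have mset: "mset bs = mset (b # ?cs)"
    using bs(4) by simp
  then have "sum_list bs = b + sum_list ?cs"
    by (metis sum_list.Cons sum_mset_sum_list)
  have "length ?cs = n"
    using bs by (simp add: length_remove1)
  moreover have "\<forall>c\<in>set ?cs. c > 0"
    using bs(3) set_remove1_subset[of b bs] by blast
  moreover have "?cs \<noteq> []" "2 * 0 + length ?cs > 2"
    using \<open>length ?cs = n\<close> bs(1) by auto
  ultimately have "odd (sum_list ?cs) \<Longrightarrow> F (1 # ?cs) = G (1 # ?cs)"
      and "even (sum_list ?cs) \<Longrightarrow> F (2 # ?cs) = G (2 # ?cs)"
    using string_equations_agree[OF F(2) G(2), of ?cs] agree by simp_all
  \<comment> \<open>The total is even, so removing 1 leaves an odd sum and removing 2 an even one,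
    exactly the parity under which the corresponding equation holds.\<close>
  then have "F (b # ?cs) = G (b # ?cs)"
    using False bs(5) \<open>sum_list bs = b + sum_list ?cs\<close> by auto
  then show ?thesis
    using genus0_background_mset_eq[OF F(1) _ bs(3) mset]
      genus0_background_mset_eq[OF G(1) _ bs(3) mset] bs by simp
qed

lemma genus0_step:
  assumes F: "genus0_background F" "string_equations 0 F"
    and G: "genus0_background G" "string_equations 0 G"
    and agree: "\<And>cs. length cs = n \<Longrightarrow> \<forall>c\<in>set cs. c > 0 \<Longrightarrow> F cs = G cs"
    and bs: "n \<ge> 3" "length bs = Suc n" "\<forall>b\<in>set bs. b > 0"
  shows "F bs = G bs"
proof -
  let ?m = "Suc n"
  let ?sq = "map (\<lambda>b. (of_nat b)\<^sup>2) :: nat list \<Rightarrow> rat list"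
  \<comment> \<open>The polynomials are given only for arguments with the odd ones first; symmetry
    carries the result back to \<open>bs\<close>.\<close>
  define cs where "cs = filter odd bs @ filter even bs"
  define k where "k = length (filter odd bs)"
  have mset: "mset bs = mset cs"
    by (simp add: cs_def)
  have len: "length cs = ?m"
    using mset bs(2) mset_eq_length by metis
  have pos: "\<forall>c\<in>set cs. c > 0"
    using bs(3) mset mset_eq_setD by metis
  have parity: "odd (cs ! i) \<longleftrightarrow> i < k" if "i < ?m" for i
  proof (cases "i < k")
    case True
    then have "cs ! i \<in> set (filter odd bs)"
      unfolding cs_def k_def nth_append by (simp del: set_filter)
    then show ?thesis using True by simp
  next
    case False
    then have "cs ! i \<in> set (filter even bs)"
      using that len unfolding cs_def k_def nth_append by (simp del: set_filter)
    then show ?thesis using False by simp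
  qed
  have "k \<le> ?m"
    using bs(2) length_filter_le[of odd bs] by (simp add: k_def)
  have "?m \<ge> 3" using bs(1) by simp
  obtain P where P: "polynomial_of_degree_le ?m (?m - 3) P"
    and F_P: "\<And>bs. length bs = ?m \<Longrightarrow> \<forall>b\<in>set bs. b > 0 \<Longrightarrow>
      \<forall>i<?m. odd (bs ! i) \<longleftrightarrow> i < k \<Longrightarrow> F bs = P (?sq bs)"
    using genus0_background_polynomial[OF F(1) \<open>?m \<ge> 3\<close> \<open>k \<le> ?m\<close>] by blast
  obtain Q where Q: "polynomial_of_degree_le ?m (?m - 3) Q"
    and G_Q: "\<And>bs. length bs = ?m \<Longrightarrow> \<forall>b\<in>set bs. b > 0 \<Longrightarrow>
      \<forall>i<?m. odd (bs ! i) \<longleftrightarrow> i < k \<Longrightarrow> G bs = Q (?sq bs)"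
    using genus0_background_polynomial[OF G(1) \<open>?m \<ge> 3\<close> \<open>k \<le> ?m\<close>] by blast
  \<comment> \<open>Each position gets the argument of a string equation that has the parity of this
    position. Any substitution from \<open>as\<close> into \<open>cs\<close> then keeps all
    parities, so \<open>P\<close> and \<open>Q\<close> still represent \<open>F\<close> and
    \<open>G\<close> there.\<close>
  define as where "as = map (\<lambda>i. if i < k then 1 else 2 :: nat) [0..<?m]"
  \<comment> \<open>The degree \<open>?m - 3\<close> is less than the number \<open>?m\<close> of
    variables. The variables are squares, so the hyperplanes are given by the squares of
    \<open>as\<close>.\<close>
  have "P (?sq cs) - Q (?sq cs) = 0"
  proof (rule polynomial_eq_0_if_vanishes_on_hyperplanes
      [OF polynomial_of_degree_le_diff[OF P Q], where as = "?sq as"])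
    fix S assume S: "S \<subseteq> {..<?m}" "S \<noteq> {}"
    define ds where "ds = map (\<lambda>i. if i \<in> S then as ! i else cs ! i) [0..<?m]"
    have "length ds = ?m" by (simp add: ds_def)
    have nth: "ds ! i = (if i \<in> S then if i < k then 1 else 2 else cs ! i)" if "i < ?m" for i
      using that by (simp add: ds_def as_def del: upt_Suc)
    have ds_pos: "\<forall>d\<in>set ds. d > 0"
      using nth len pos \<open>length ds = ?m\<close> by (auto simp: all_set_conv_all_nth)
    have ds_parity: "\<forall>i<?m. odd (ds ! i) \<longleftrightarrow> i < k"
      using nth parity by simp
    from S obtain i where "i \<in> S" "i < ?m" by blast
    then have "ds ! i = 1 \<or> ds ! i = 2"
      using nth by simp
    moreover have "ds ! i \<in> set ds"
      using \<open>i < ?m\<close> \<open>length ds = ?m\<close> by (intro nth_mem) simp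
    ultimately have "F ds = G ds"
      using genus0_step_special[OF F G agree bs(1) \<open>length ds = ?m\<close> ds_pos] by blast
    then have "P (?sq ds) - Q (?sq ds) = 0"
      using F_P G_Q \<open>length ds = ?m\<close> ds_pos ds_parity by simp
    \<comment> \<open>Squaring commutes with the substitution, so the vanishing at the integer list
      \<open>ds\<close> is the vanishing asked for.\<close>
    moreover have "?sq ds = map (\<lambda>i. if i \<in> S then ?sq as ! i else ?sq cs ! i) [0..<?m]"
      using len by (auto intro!: nth_equalityI simp: ds_def as_def simp del: upt_Suc)
    ultimately show "P (map (\<lambda>i. if i \<in> S then ?sq as ! i else ?sq cs ! i) [0..<?m]) -
        Q (map (\<lambda>i. if i \<in> S then ?sq as ! i else ?sq cs ! i) [0..<?m]) = 0"
      by simp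
  qed (use len bs(1) in auto)
  then have "F cs = G cs"
    using F_P G_Q len pos parity by simp
  then show ?thesis
    using genus0_background_mset_eq[OF F(1) _ bs(3) mset]
      genus0_background_mset_eq[OF G(1) _ bs(3) mset] bs by simp
qed

text \<open>The induction starts at three arguments, where the background facts prescribe all
  values.\<close>

lemma genus0_unique:
  assumes F: "genus0_background F" "string_equations 0 F"
    and G: "genus0_background G" "string_equations 0 G"
    and "n \<ge> 3" "length bs = n" "\<forall>b\<in>set bs. b > 0"
  shows "F bs = G bs"
  using assms(5-7)
proof (induction n arbitrary: bs rule: nat_induct_at_least)
  case base
  then obtain b1 b2 b3 where "bs = [b1, b2, b3]"
    by (auto simp: eval_nat_numeral length_Suc_conv)
  then show ?case
    using base F(1) G(1) by (simp add: genus0_background_def)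
next
  case (Suc n)
  show ?case
    by (rule genus0_step[OF F G Suc.IH Suc.hyps Suc.prems])
qed

text \<open>The first two hypotheses make \<open>Ngn 0\<close> itself a solution; that the equations
  determine it means that every solution \<open>F\<close> with the same background properties
  coincides with it.\<close>

theorem corollary1:
  fixes F :: "nat list \<Rightarrow> rat" and bs :: "nat list"
  assumes "genus0_background (Ngn 0)" and "string_equations 0 (Ngn 0)"
    and "genus0_background F" and "string_equations 0 F"
    and "length bs \<ge> 3" and "\<forall>b\<in>set bs. b > 0"
  shows "F bs = Ngn 0 bs"
  using genus0_unique[OF assms(3,4,1,2,5) refl assms(6)] .

end
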